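(* Let $n\ge 0$ be an integer and let $\mathcal T_n$ be the set of deals defined in the context. Then for every integer $k$ with $0\le k\le n$: (i) the number of deals in $\mathcal T_n$ whose denomination set $S$ satisfies $|S|=k$ is $$\binom{n}{k}\sum_{j=0}^{k}\binom{k}{j}^{3};$$ (ii) the number of deals in $\mathcal T_n$ for which exactly $k$ distinct denominations occur in the red player's hand is $$\binom{n}{k}^{2}\binom{2k}{k}.$$
   Context: Consider a deck of $3n$ distinct cards: for each color in $\{\text{red},\text{green},\text{blue}\}$ and each denomination $i\in\{1,\dots,n\}$ there is exactly one card of that color and denomination. A deal in $\mathcal T_n$ is obtained as follows: choose a subset $S\subseteq\{1,\dots,n\}$ of the denominations (possibly empty), and partition all $3|S|$ cards whose denomination lies in $S$ into an ordered list of three sets (hands) $(H_{\mathrm{red}},H_{\mathrm{green}},H_{\mathrm{blue}})$ of equal size (so each has $|S|$ cards), such that $H_{\mathrm{red}}$ contains no red card, $H_{\mathrm{green}}$ contains no green card, and $H_{\mathrm{blue}}$ contains no blue card. The hands are unordered sets of cards, and $H_{c}$ is called the hand of the player designated $c$. When $S=\emptyset$ all three hands are empty, which gives one deal. $\mathcal T_n$ is the set of all triples $(H_{\mathrm{red}},H_{\mathrm{green}},H_{\mathrm{blue}})$ obtained in this way, over all choices of $S$; $S$ is the denomination set of the deal. A denomination $i$ occurs in a hand if the hand contains at least one card of denomination $i$. *)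

theory Defs
  imports Main "HOL-Library.Disjoint_Sets"
begin

datatype color = Red | Green | Blue

type_synonym playing_card = "color \<times> nat"

definition deck :: "nat set \<Rightarrow> playing_card set" where
  "deck S = {(c, i) | c i. i \<in> S}"

text \<open>
  A triple of hands is a function from players (designated by colors) to sets of cards.
  Hands may be empty (when \<open>S = {}\<close>), so the library predicate \<open>partition_on\<close>,
  which excludes empty blocks and loses the order of the hands, is not used.
\<close>
definition deals_on :: "nat set \<Rightarrow> (color \<Rightarrow> playing_card set) set" where
  "deals_on S = {H. (\<Union>c. H c) = deck S \<and> disjoint_family H \<and>
     (\<forall>c. card (H c) = card S) \<and> (\<forall>c. \<forall>x \<in> H c. fst x \<noteq> c)}"

definition deals :: "nat \<Rightarrow> (color \<Rightarrow> playing_card set) set" where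
  "deals n = (\<Union>S \<in> Pow {1..n}. deals_on S)"

definition denomination_set :: "(color \<Rightarrow> playing_card set) \<Rightarrow> nat set" where
  "denomination_set H = (THE S. H \<in> deals_on S)"

lemma denomination_set_eq:
  assumes "H \<in> deals_on S"
  shows "denomination_set H = S"
proof -
  have inj: "A = B" if "deck A = deck B" for A B
    using that unfolding deck_def by blast
  show ?thesis
    unfolding denomination_set_def
  proof (rule the_equality)
    show "H \<in> deals_on S" by (rule assms)
    fix T assume "H \<in> deals_on T"
    then show "T = S"
      using assms by (intro inj) (simp add: deals_on_def)
  qed
qed

definition occurring :: "playing_card set \<Rightarrow> nat set" where
  "occurring h = {i. \<exists>x \<in> h. snd x = i}"

end

theory Submission
  imports Defs
begin

text \<open>
  A deal on \<open>S\<close> is determined by the set \<open>A\<close> of denominations whose red card goes to the green player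
  (the others go to blue), the set \<open>B\<close> of those whose green card goes to blue, and the set \<open>C\<close> of
  those whose blue card goes to red. The hands have equal size iff \<open>A\<close>, \<open>B\<close>, \<open>C\<close> do, which gives
  the sum of cubes. The red hand misses exactly the denominations in \<open>E = B - C\<close>. Let
  \<open>D = S - E\<close> and \<open>G = C - B\<close>, so \<open>card G = card E\<close>. Choosing \<open>D\<close>, \<open>E\<close>, \<open>C\<close>, \<open>G\<close>, \<open>A\<close> in this order
  gives the double sum of \<open>(n choose k) (n-k choose e) (k choose c) (c choose e) (k+e choose c)\<close>
  over \<open>e\<close> and \<open>c\<close>, and two applications of Vandermonde's identity evaluate it.
\<close>

section \<open>Encoding deals by triples of denomination sets\<close>

definition hands :: "nat set \<Rightarrow> nat set \<Rightarrow> nat set \<Rightarrow> nat set \<Rightarrow> color \<Rightarrow> playing_card set" where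
  "hands S A B C c = (case c of
      Red \<Rightarrow> Pair Green ` (S - B) \<union> Pair Blue ` C
    | Green \<Rightarrow> Pair Red ` A \<union> Pair Blue ` (S - C)
    | Blue \<Rightarrow> Pair Red ` (S - A) \<union> Pair Green ` B)"

text \<open>These triples encode the deals on a finite \<open>S\<close>. In the dependent form every
  fibre over \<open>A\<close> has \<open>(card S choose card A) ^ 2\<close> elements, so the
  cardinality can be read off.\<close>

definition equal_triples :: "nat set \<Rightarrow> (nat set \<times> nat set \<times> nat set) set" where
  "equal_triples S = (SIGMA A:Pow S. {B. B \<subseteq> S \<and> card B = card A} \<times> {C. C \<subseteq> S \<and> card C = card A})"

lemma all_color: "(\<forall>c. P c) \<longleftrightarrow> P Red \<and> P Green \<and> P Blue"
  by (metis color.exhaust)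

lemma ex_color: "(\<exists>c. P c) \<longleftrightarrow> P Red \<or> P Green \<or> P Blue"
  by (metis color.exhaust)

lemma card_tagged_Un:
  assumes "finite X" "finite Y" "a \<noteq> b"
  shows "card (Pair a ` X \<union> Pair b ` Y) = card X + card Y"
  using assms by (subst card_Un_disjoint) (auto simp: card_image inj_on_def)

lemma card_hands:
  assumes "finite S" "A \<subseteq> S" "B \<subseteq> S" "C \<subseteq> S"
  shows "card (hands S A B C Red) = card S - card B + card C"
    and "card (hands S A B C Green) = card A + (card S - card C)"
    and "card (hands S A B C Blue) = card S - card A + card B"
  using assms by (auto simp: hands_def card_tagged_Un card_Diff_subset finite_subset)

lemma hands_in_deals_on:
  assumes "finite S" "(A, B, C) \<in> equal_triples S"
  shows "hands S A B C \<in> deals_on S"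
proof -
  have sub: "A \<subseteq> S" "B \<subseteq> S" "C \<subseteq> S" and eq: "card B = card A" "card C = card A"
    using assms(2) by (auto simp: equal_triples_def)
  have le: "card A \<le> card S"
    using assms(1) sub(1) by (rule card_mono)
  \<comment> \<open>A table of who holds which card: each card of \<open>deck S\<close> satisfies
    exactly one row, so union, disjointness and the color restriction become propositional.\<close>
  have mem: "(d, i) \<in> hands S A B C c \<longleftrightarrow>
      (c = Red \<and> d = Green \<and> i \<in> S - B) \<or> (c = Red \<and> d = Blue \<and> i \<in> C) \<or>
      (c = Green \<and> d = Red \<and> i \<in> A) \<or> (c = Green \<and> d = Blue \<and> i \<in> S - C) \<or>
      (c = Blue \<and> d = Red \<and> i \<in> S - A) \<or> (c = Blue \<and> d = Green \<and> i \<in> B)" for c d i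
    by (cases c) (auto simp: hands_def)
  have "(d, i) \<in> (\<Union>c. hands S A B C c) \<longleftrightarrow> (d, i) \<in> deck S" for d i
    using sub by (cases d) (auto simp: mem deck_def ex_color)
  then have "(\<Union>c. hands S A B C c) = deck S"
    by (intro set_eqI) (metis surj_pair)
  moreover have "disjoint_family (hands S A B C)"
    unfolding disjoint_family_on_def by (auto simp: mem)
  moreover have "\<forall>c. card (hands S A B C c) = card S"
    using card_hands[OF assms(1) sub] eq le by (simp add: all_color)
  moreover have "\<forall>c. \<forall>x \<in> hands S A B C c. fst x \<noteq> c"
    by (auto simp: mem)
  ultimately show ?thesis
    by (simp add: deals_on_def)
qed

lemma deals_on_eq_hands:
  assumes "finite S" "H \<in> deals_on S"
  obtains A B C where "(A, B, C) \<in> equal_triples S" "H = hands S A B C"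
proof -
  define A B C where "A = {i. (Red, i) \<in> H Green}" and "B = {i. (Green, i) \<in> H Blue}"
    and "C = {i. (Blue, i) \<in> H Red}"
  have un: "\<And>d i. (\<exists>c. (d, i) \<in> H c) \<longleftrightarrow> i \<in> S"
    using assms(2) by (auto simp: deals_on_def deck_def set_eq_iff)
  have disj: "\<And>c c' x. x \<in> H c \<Longrightarrow> x \<in> H c' \<Longrightarrow> c = c'"
    using assms(2) by (auto simp: deals_on_def disjoint_family_on_def)
  have own: "\<And>c i. (c, i) \<notin> H c"
    using assms(2) by (fastforce simp: deals_on_def)
  have card: "\<And>c. card (H c) = card S"
    using assms(2) by (auto simp: deals_on_def)
  have sub: "A \<subseteq> S" "B \<subseteq> S" "C \<subseteq> S"
    using un unfolding A_def B_def C_def by blast+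
  \<comment> \<open>Each card with denomination in \<open>S\<close> has exactly one holder, and its
    own color is excluded, so not being with one of the two other players means being with the
    other.\<close>
  have R: "(Red, i) \<in> H Blue \<longleftrightarrow> i \<in> S - A"
    and G: "(Green, i) \<in> H Red \<longleftrightarrow> i \<in> S - B"
    and B: "(Blue, i) \<in> H Green \<longleftrightarrow> i \<in> S - C" for i
    using un[of _ i] disj own unfolding A_def B_def C_def mem_Collect_eq Diff_iff
    by (metis color.exhaust color.distinct)+
  have "(d, i) \<in> H c \<longleftrightarrow> (d, i) \<in> hands S A B C c" for c d i
    by (cases c; cases d) (auto simp: hands_def own R G B, auto simp: A_def B_def C_def)
  then have H: "H = hands S A B C"
    by (intro ext set_eqI) (metis surj_pair)
  \<comment> \<open>These bounds make the truncated differences in \<open>card_hands\<close>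
    genuine; the hand sizes then force \<open>card C = card B\<close> (red) and
    \<open>card A = card C\<close> (green).\<close>
  have "card A \<le> card S" "card B \<le> card S" "card C \<le> card S"
    using assms(1) sub by (auto intro: card_mono)
  then have "card B = card A" "card C = card A"
    using card_hands[OF assms(1) sub] card[of Red] card[of Green] card[of Blue]
    unfolding H by linarith+
  with sub have "(A, B, C) \<in> equal_triples S"
    by (simp add: equal_triples_def)
  then show thesis
    using H that by blast
qed

text \<open>The hands reveal \<open>A\<close>, \<open>B\<close>, \<open>C\<close> and also
  \<open>S - A\<close>, hence \<open>S\<close> as the union of \<open>A\<close> and
  \<open>S - A\<close>. So deals for different \<open>S\<close> never coincide, and one count can
  run over all \<open>S\<close>.\<close>

lemma inj_on_hands: "inj_on (\<lambda>(S, A, B, C). hands S A B C) (Sigma UNIV equal_triples)"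
proof -
  have rec: "A = {i. (Red, i) \<in> hands S A B C Green}" "B = {i. (Green, i) \<in> hands S A B C Blue}"
       "C = {i. (Blue, i) \<in> hands S A B C Red}" "S - A = {i. (Red, i) \<in> hands S A B C Blue}" for S A B C
    by (auto simp: hands_def)
  have "S = S' \<and> A = A' \<and> B = B' \<and> C = C'"
    if "hands S A B C = hands S' A' B' C'" "A \<subseteq> S" "A' \<subseteq> S'" for S A B C S' A' B' C'
  proof -
    have "A = A'" "B = B'" "C = C'" "S - A = S' - A'"
      using rec[where S = S and A = A and B = B and C = C]
        rec[where S = S' and A = A' and B = B' and C = C'] that(1) by simp_all
    then show ?thesis
      using that(2,3) by blast
  qed
  then show ?thesis
    unfolding inj_on_def equal_triples_def by (auto 0 0; blast)
qed

text \<open>Red misses a denomination of \<open>S\<close> exactly when its green card goes to blue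
  and its blue card goes to green.\<close>

lemma occurring_hands_Red:
  assumes "C \<subseteq> S"
  shows "occurring (hands S A B C Red) = S - (B - C)"
  using assms by (force simp: occurring_def hands_def)

text \<open>Reduces both counts of the theorem to counting quadruples; \<open>P\<close> is later
  instantiated by the condition on the denomination set and by the one on the red hand.\<close>

lemma card_deals_filter:
  "card {H \<in> deals n. P H} =
   card {(S, A, B, C). S \<subseteq> {1..n} \<and> (A, B, C) \<in> equal_triples S \<and> P (hands S A B C)}"
  (is "card ?L = card ?R")
proof -
  have fin: "finite S" if "S \<subseteq> {1..n}" for S
    using that finite_subset by blast
  have "?L = (\<lambda>(S, A, B, C). hands S A B C) ` ?R"
  proof (intro set_eqI iffI)
    fix H assume "H \<in> ?L"
    then obtain S where S: "S \<subseteq> {1..n}" "H \<in> deals_on S" "P H"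
      by (auto simp: deals_def)
    then obtain A B C where "(A, B, C) \<in> equal_triples S" "H = hands S A B C"
      using deals_on_eq_hands fin by metis
    with S show "H \<in> (\<lambda>(S, A, B, C). hands S A B C) ` ?R"
      by (intro image_eqI[where x = "(S, A, B, C)"]) simp_all
  next
    fix H assume "H \<in> (\<lambda>(S, A, B, C). hands S A B C) ` ?R"
    then obtain S A B C where S: "S \<subseteq> {1..n}" and T: "(A, B, C) \<in> equal_triples S"
      and H: "H = hands S A B C" and P: "P (hands S A B C)"
      by auto
    have "H \<in> deals_on S"
      unfolding H using fin[OF S] T by (rule hands_in_deals_on)
    with S P H show "H \<in> ?L"
      by (auto simp: deals_def)
  qed
  moreover have "inj_on (\<lambda>(S, A, B, C). hands S A B C) ?R"
    by (rule inj_on_subset[OF inj_on_hands]) auto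
  ultimately show ?thesis
    by (simp add: card_image)
qed

section \<open>Counting by the size of the denomination set\<close>

lemma sum_Pow_card:
  fixes f :: "nat \<Rightarrow> nat"
  assumes "finite S"
  shows "(\<Sum>A\<in>Pow S. f (card A)) = (\<Sum>j\<le>card S. (card S choose j) * f j)"
proof -
  have "(\<Sum>A\<in>Pow S. f (card A)) = (\<Sum>j\<le>card S. \<Sum>A\<in>{A \<in> Pow S. card A = j}. f (card A))"
    using assms by (intro sum.group[symmetric]) (auto intro: card_mono)
  also have "\<dots> = (\<Sum>j\<le>card S. (card S choose j) * f j)"
    using n_subsets[OF assms] by simp
  finally show ?thesis .
qed

text \<open>\<open>B\<close> and \<open>C\<close> contribute a square for each \<open>A\<close>;
  grouping the sets \<open>A\<close> by cardinality supplies the third factor.\<close>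

lemma card_equal_triples:
  assumes "finite S"
  shows "card (equal_triples S) = (\<Sum>j\<le>card S. (card S choose j) ^ 3)"
proof -
  have "card (equal_triples S) = (\<Sum>A\<in>Pow S. (card S choose card A) ^ 2)"
    unfolding equal_triples_def using assms
    by (subst card_SigmaI) (auto simp: card_cartesian_product n_subsets power2_eq_square)
  also have "\<dots> = (\<Sum>j\<le>card S. (card S choose j) ^ 3)"
    using sum_Pow_card[OF assms, of "\<lambda>j. (card S choose j) ^ 2"]
    by (simp add: power3_eq_cube power2_eq_square mult.assoc)
  finally show ?thesis .
qed

lemma finite_equal_triples: "finite S \<Longrightarrow> finite (equal_triples S)"
  unfolding equal_triples_def by (intro finite_SigmaI) auto

lemma card_deals_denomination_set:
  "card {H \<in> deals n. card (denomination_set H) = k}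
     = (n choose k) * (\<Sum>j\<le>k. (k choose j) ^ 3)"
proof -
  have fin: "finite S" if "S \<subseteq> {1..n}" for S
    using that finite_subset by blast
  have "denomination_set (hands S A B C) = S"
    if "S \<subseteq> {1..n}" "(A, B, C) \<in> equal_triples S" for S A B C
    using that fin by (intro denomination_set_eq hands_in_deals_on)
  then have "{(S, A, B, C). S \<subseteq> {1..n} \<and> (A, B, C) \<in> equal_triples S
        \<and> card (denomination_set (hands S A B C)) = k}
      = (SIGMA S:{S. S \<subseteq> {1..n} \<and> card S = k}. equal_triples S)"
    by auto
  then show ?thesis
    by (simp add: card_deals_filter card_SigmaI fin finite_equal_triples card_equal_triples n_subsets)
qed

section \<open>Two consequences of Vandermonde's identity\<close>

lemma sum_choose_choose_choose:
  "(\<Sum>c\<le>k. (k choose c) * ((c choose e) * ((k + e) choose c))) = (k choose e) * ((2 * k) choose k)"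
proof (cases "e \<le> k")
  case True
  \<comment> \<open>Choosing a \<open>c\<close>-set and then an \<open>e\<close>-set inside it
    amounts to choosing the \<open>e\<close>-set first and extending it; complementing the extension
    gives the lower index \<open>k - c\<close>. For \<open>c < e\<close> both sides are 0.\<close>
  have "(k choose c) * ((c choose e) * ((k + e) choose c))
      = (k choose e) * (((k + e) choose c) * ((k - e) choose (k - c)))" if "c \<le> k" for c
  proof (cases "e \<le> c")
    case True
    have "(k - e) choose (c - e) = (k - e) choose (k - c)"
      using True that binomial_symmetric[of "c - e" "k - e"] by simp
    then show ?thesis
      using choose_mult[OF True that] by (simp add: mult_ac)
  next
    case False
    with \<open>e \<le> k\<close> have "k - e < k - c"
      by linarith
    with False show ?thesis
      by (simp add: binomial_eq_0)
  qed
  then have "(\<Sum>c\<le>k. (k choose c) * ((c choose e) * ((k + e) choose c)))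
      = (k choose e) * (\<Sum>c\<le>k. ((k + e) choose c) * ((k - e) choose (k - c)))"
    unfolding sum_distrib_left by (intro sum.cong) auto
  \<comment> \<open>The upper indices \<open>k + e\<close> and \<open>k - e\<close> add up to
    \<open>2 * k\<close>, so \<open>e\<close> disappears from the sum.\<close>
  also have "(\<Sum>c\<le>k. ((k + e) choose c) * ((k - e) choose (k - c))) = (2 * k) choose k"
    using True by (simp add: vandermonde mult_2)
  finally show ?thesis .
qed (simp add: binomial_eq_0)

text \<open>Replacing \<open>e\<close> by \<open>n - k - e\<close> in one factor turns the sum into
  the Vandermonde convolution for \<open>n choose (n - k)\<close>.\<close>

lemma sum_choose_complement:
  assumes "k \<le> n"
  shows "(\<Sum>e\<le>n - k. ((n - k) choose e) * (k choose e)) = n choose k"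
proof -
  have "(\<Sum>e\<le>n - k. ((n - k) choose e) * (k choose e)) =
        (\<Sum>e\<le>n - k. (k choose e) * ((n - k) choose (n - k - e)))"
    by (intro sum.cong refl) (metis atMost_iff binomial_symmetric mult.commute)
  also have "\<dots> = n choose (n - k)"
    using assms vandermonde[of k "n - k" "n - k"] by simp
  finally show ?thesis
    using assms by (simp add: binomial_symmetric[symmetric])
qed

section \<open>Counting by the denominations in the red hand\<close>

lemma card_deals_occurring_Red:
  assumes "k \<le> n"
  shows "card {H \<in> deals n. card (occurring (H Red)) = k} = (n choose k) ^ 2 * ((2 * k) choose k)"
proof -
  define N where "N = {1..n}"
  have fin: "finite X" if "X \<subseteq> N" for X
    using that finite_subset unfolding N_def by blast
  define Y where "Y = {(S, A, B, C). S \<subseteq> N \<and> (A, B, C) \<in> equal_triples S \<and> card (S - (B - C)) = k}"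
  \<comment> \<open>In this order of choice the size of each range depends only on the cardinalities
    of the sets chosen before.\<close>
  define X where "X = (SIGMA D:{D. D \<subseteq> N \<and> card D = k}. SIGMA E:Pow (N - D). SIGMA C:Pow D.
      {G. G \<subseteq> C \<and> card G = card E} \<times> {A. A \<subseteq> D \<union> E \<and> card A = card C})"
  have "card {H \<in> deals n. card (occurring (H Red)) = k} = card Y"
    unfolding card_deals_filter Y_def N_def
    by (intro arg_cong[where f = card]) (auto simp: occurring_hands_Red equal_triples_def)
  also have "card Y = card X"
  proof (rule bij_betw_same_card)
    show "bij_betw (\<lambda>(S, A, B, C). (S - (B - C), B - C, C, C - B, A)) Y X"
    \<comment> \<open>\<open>B\<close> is recovered from its parts inside and outside
      \<open>C\<close>: the former is \<open>C - G\<close>, the latter is \<open>E\<close>.\<close>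
    proof (rule bij_betw_byWitness[where f' = "\<lambda>(D, E, C, G, A). (D \<union> E, A, (C - G) \<union> E, C)"])
      show "(\<lambda>(S, A, B, C). (S - (B - C), B - C, C, C - B, A)) ` Y \<subseteq> X"
      proof clarify
        fix S A B C assume Y: "(S, A, B, C) \<in> Y"
        then have sub: "S \<subseteq> N" "A \<subseteq> S" "B \<subseteq> S" "C \<subseteq> S"
          and eq: "card B = card A" "card C = card A" and k: "card (S - (B - C)) = k"
          by (auto simp: Y_def equal_triples_def)
        have "finite B" "finite C"
          using sub fin by blast+
        \<comment> \<open>Both differences arise from sets of equal size by removing the common
          intersection.\<close>
        then have "card (C - B) = card (B - C)"
          using eq by (metis card_Diff_subset_Int finite_Int inf_commute)
        then show "(S - (B - C), B - C, C, C - B, A) \<in> X"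
          using sub eq k by (auto simp: X_def)
      qed
      show "(\<lambda>(D, E, C, G, A). (D \<union> E, A, (C - G) \<union> E, C)) ` X \<subseteq> Y"
      proof clarify
        fix D E C G A assume X: "(D, E, C, G, A) \<in> X"
        then have sub: "D \<subseteq> N" "E \<subseteq> N - D" "C \<subseteq> D" "G \<subseteq> C" "A \<subseteq> D \<union> E"
          and eq: "card G = card E" "card A = card C" "card D = k"
          by (auto simp: X_def)
        have f: "finite C" "finite E" "finite G"
          using sub fin by blast+
        \<comment> \<open>\<open>E\<close> avoids \<open>D\<close> and hence \<open>C\<close>;
          exchanging \<open>G\<close> for the equally large \<open>E\<close> preserves the size of
          \<open>C\<close>.\<close>
        have "card ((C - G) \<union> E) = card (C - G) + card E"
          using f sub by (intro card_Un_disjoint) auto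
        also have "\<dots> = card C"
          using f sub(4) eq by (metis card_Diff_subset card_mono le_add_diff_inverse2)
        finally have "card ((C - G) \<union> E) = card C" .
        moreover have "(D \<union> E) - (((C - G) \<union> E) - C) = D"
          using sub by blast
        ultimately show "(D \<union> E, A, (C - G) \<union> E, C) \<in> Y"
          using sub eq by (auto simp: Y_def equal_triples_def)
      qed
    qed (auto simp: X_def Y_def equal_triples_def)
  qed
  also have "card X = (\<Sum>D\<in>{D. D \<subseteq> N \<and> card D = k}. \<Sum>E\<in>Pow (N - D). \<Sum>C\<in>Pow D.
      (card C choose card E) * ((k + card E) choose card C))"
  proof -
    \<comment> \<open>\<open>P\<close> names the innermost range, so that finiteness and cardinality
      can be carried outwards one \<open>SIGMA\<close> at a time.\<close>
    define P where "P D E C = {G. G \<subseteq> C \<and> card G = card E} \<times> {A. A \<subseteq> D \<union> E \<and> card A = card C}"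
      for D E C :: "nat set"
    have finN: "finite N"
      by (simp add: fin)
    have P: "finite (P D E C)" "card (P D E C) = (card C choose card E) * ((k + card E) choose card C)"
      if "D \<subseteq> N" "card D = k" "E \<subseteq> N - D" "C \<subseteq> D" for C D E
    proof -
      have f: "finite C" "finite D" "finite E"
        using that fin by blast+
      moreover have "card (D \<union> E) = k + card E"
        using f that by (subst card_Un_disjoint) auto
      ultimately show "finite (P D E C)"
        "card (P D E C) = (card C choose card E) * ((k + card E) choose card C)"
        by (simp_all add: P_def card_cartesian_product n_subsets)
    qed
    have PC: "finite (SIGMA C:Pow D. P D E C)"
        "card (SIGMA C:Pow D. P D E C)
          = (\<Sum>C\<in>Pow D. (card C choose card E) * ((k + card E) choose card C))"
      if "D \<subseteq> N" "card D = k" "E \<subseteq> N - D" for D E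
      using that by (auto simp: fin P card_SigmaI intro!: finite_SigmaI)
    have PEC: "finite (SIGMA E:Pow (N - D). SIGMA C:Pow D. P D E C)"
        "card (SIGMA E:Pow (N - D). SIGMA C:Pow D. P D E C)
          = (\<Sum>E\<in>Pow (N - D). \<Sum>C\<in>Pow D. (card C choose card E) * ((k + card E) choose card C))"
      if "D \<subseteq> N" "card D = k" for D
    proof -
      show "finite (SIGMA E:Pow (N - D). SIGMA C:Pow D. P D E C)"
        by (rule finite_SigmaI) (simp_all add: PC(1)[OF that] finN)
      show "card (SIGMA E:Pow (N - D). SIGMA C:Pow D. P D E C)
          = (\<Sum>E\<in>Pow (N - D). \<Sum>C\<in>Pow D. (card C choose card E) * ((k + card E) choose card C))"
        by (subst card_SigmaI) (simp_all add: PC[OF that] finN)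
    qed
    show ?thesis
      unfolding X_def P_def[symmetric] using finN by (subst card_SigmaI) (simp_all add: PEC)
  qed
  \<comment> \<open>The inner double sum is the same for every \<open>D\<close>; the choice of
    \<open>D\<close> then supplies the second factor \<open>n choose k\<close>.\<close>
  also have "\<dots> = (\<Sum>D\<in>{D. D \<subseteq> N \<and> card D = k}. (n choose k) * ((2 * k) choose k))"
  proof (intro sum.cong refl, clarify)
    fix D assume D: "D \<subseteq> N" "k = card D"
    have card: "card (N - D) = n - k"
      using D fin by (simp add: card_Diff_subset N_def)
    \<comment> \<open>Summing over \<open>C\<close> splits off the central binomial coefficient,
      which is independent of \<open>E\<close>; what is left is the sum in
      \<open>sum_choose_complement\<close>.\<close>
    have "(\<Sum>E\<in>Pow (N - D). \<Sum>C\<in>Pow D. (card C choose card E) * ((k + card E) choose card C))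
        = (\<Sum>E\<in>Pow (N - D). (k choose card E) * ((2 * k) choose k))"
      using sum_Pow_card[OF fin[OF D(1)], of "\<lambda>c. (c choose e) * ((k + e) choose c)" for e]
      by (simp add: D(2)[symmetric] sum_choose_choose_choose)
    also have "\<dots> = (\<Sum>e\<le>n - k. ((n - k) choose e) * (k choose e)) * ((2 * k) choose k)"
      using sum_Pow_card[OF fin[of "N - D"], of "\<lambda>e. k choose e"]
      by (simp add: card sum_distrib_right[symmetric])
    finally show "(\<Sum>E\<in>Pow (N - D). \<Sum>C\<in>Pow D.
        (card C choose card E) * ((card D + card E) choose card C))
        = (n choose card D) * ((2 * card D) choose card D)"
      using sum_choose_complement[OF assms] by (simp add: D(2))
  qed
  also have "\<dots> = (n choose k) ^ 2 * ((2 * k) choose k)"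
    using n_subsets[of N k] by (simp add: N_def power2_eq_square)
  finally show ?thesis .
qed

theorem mainTheorem1:
  fixes n k :: nat
  assumes "k \<le> n"
  shows "card {H \<in> deals n. card (denomination_set H) = k}
           = (n choose k) * (\<Sum>j=0..k. (k choose j) ^ 3)
       \<and> card {H \<in> deals n. card (occurring (H Red)) = k}
           = (n choose k) ^ 2 * ((2 * k) choose k)"
  using card_deals_denomination_set card_deals_occurring_Red[OF assms]
  by (simp add: atLeast0AtMost)

end
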